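(* Whenever all the series concerned are either convergent or terminating, $$\sum_{m,n=0}^\infty\frac{(3/2,m+n)(-1)^m 2^{-1-2m-2n}x^{m+n}}{(1/2,m)(3/2,n)\,m!\,n!}H_{2m}(iy^{1/2})\,H_{2n+1}(y^{1/2})=y^{1/2}\exp(4xy).$$
   Context: Here $x,y$ are complex variables and $i^2=-1$. $(\alpha,n)=\alpha(\alpha+1)\cdots(\alpha+n-1)$ for $n\ge1$ and $(\alpha,0)=1$ (Pochhammer symbol). $H_n$ is the Hermite polynomial in the standard normalization $\sum_{n\ge0}H_n(z)t^n/n!=e^{2zt-t^2}$. *)

theory Defs
  imports "HOL-Complex_Analysis.Complex_Analysis"
begin

definition hermite_H :: "nat \<Rightarrow> complex \<Rightarrow> complex" where
  "hermite_H n z =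
     fact n * fps_nth (fps_exp 1 oo (fps_const (2 * z) * fps_X - fps_X ^ 2)) n"

text \<open>
  The formal power series in \<^term>\<open>hermite_H\<close> has infinite radius of convergence, so the
  generating function \<open>exp (2 z t - t\<^sup>2)\<close> is attained at every complex \<open>t\<close>.
\<close>

lemma hermite_H_generating_function:
  "(\<lambda>n. hermite_H n z * t ^ n / fact n) sums exp (2 * z * t - t ^ 2)"
proof -
  have "(exp \<circ> (\<lambda>t. 2 * z * t - t ^ 2)) has_fps_expansion
          (fps_exp 1 oo (fps_const (2 * z) * fps_X - fps_X ^ 2))"
    by (intro has_fps_expansion_compose has_fps_expansion_exp1 has_fps_expansion_diff
          has_fps_expansion_mult has_fps_expansion_const has_fps_expansion_fps_X
          has_fps_expansion_fps_X_power) (simp add: fps_X_def)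
  then have "(\<lambda>n. fps_nth (fps_exp 1 oo (fps_const (2 * z) * fps_X - fps_X ^ 2)) n * t ^ n)
               sums (exp \<circ> (\<lambda>t. 2 * z * t - t ^ 2)) t"
    by (rule has_fps_expansion_imp_sums_complex[where r = \<infinity>])
       (auto intro!: holomorphic_intros simp: o_def)
  then show ?thesis
    by (simp add: hermite_H_def)
qed

text \<open>
  The summand depends on \<open>y\<close> only through the square root \<open>s\<close> of \<open>y\<close>.
\<close>

definition hermite_series_term :: "complex \<Rightarrow> complex \<Rightarrow> nat \<Rightarrow> nat \<Rightarrow> complex" where
  "hermite_series_term x s m n =
     pochhammer (3/2) (m + n) * (-1) ^ m * 2 powi (- 1 - 2 * int m - 2 * int n) * x ^ (m + n)
       / (pochhammer (1/2) m * pochhammer (3/2) n * fact m * fact n)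
       * hermite_H (2 * m) (\<i> * s) * hermite_H (2 * n + 1) s"

end

(* On the diagonal m + n = N the Pochhammer symbols turn the summand into a multiple of
   (-1)^m H_{2m}(i s) / (2m)! * H_{2n+1}(s) / (2n+1)!.  Up to that multiple, the diagonal sum is
   thus the coefficient of t^(2N+1) in the product of the even part of exp (t^2 - 2 s t) and the
   odd part of exp (2 s t - t^2), which is cosh (2 s t) * sinh (2 s t) = sinh (4 s t) / 2. *)

theory Submission
  imports Defs
begin

text \<open>Taylor series in t of the Hermite generating function at \<open>c * t\<close>. The
  scalings \<open>c\<close> = 1, -1 isolate the odd part; \<open>c\<close> = \<open>\<i>\<close>,
  \<open>- \<i>\<close> isolate the even part and supply the sign (-1)^m =
  \<open>\<i>\<close>^(2m).\<close>

definition hermite_gen_fps :: "complex \<Rightarrow> complex \<Rightarrow> complex fps" where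
  "hermite_gen_fps z c = Abs_fps (\<lambda>n. c ^ n * (hermite_H n z / fact n))"

lemma hermite_gen_fps_expansion:
  "(\<lambda>t. exp (2 * z * (c * t) - (c * t) ^ 2)) has_fps_expansion hermite_gen_fps z c"
proof -
  have 1: "(exp \<circ> (\<lambda>t. 2 * z * t - t ^ 2)) has_fps_expansion
          (fps_exp 1 oo (fps_const (2 * z) * fps_X - fps_X ^ 2))"
    by (intro has_fps_expansion_compose has_fps_expansion_exp1 has_fps_expansion_diff
          has_fps_expansion_mult has_fps_expansion_const has_fps_expansion_fps_X
          has_fps_expansion_fps_X_power) (simp add: fps_X_def)
  have "((exp \<circ> (\<lambda>t. 2 * z * t - t ^ 2)) \<circ> (\<lambda>t. c * t)) has_fps_expansion
          ((fps_exp 1 oo (fps_const (2 * z) * fps_X - fps_X ^ 2)) oo (fps_const c * fps_X))"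
    by (intro has_fps_expansion_compose 1 has_fps_expansion_mult has_fps_expansion_const
          has_fps_expansion_fps_X) simp
  also have "(fps_exp 1 oo (fps_const (2 * z) * fps_X - fps_X ^ 2)) oo (fps_const c * fps_X)
      = hermite_gen_fps z c"
    unfolding hermite_gen_fps_def fps_compose_linear by (simp add: hermite_H_def)
  finally show ?thesis by (simp add: o_def)
qed

text \<open>At argument \<open>\<i> * s\<close> the two exponents are t^2 - 2st and t^2 + 2st, at
  \<open>s\<close> they are 2st - t^2 and -2st - t^2. The Gaussian factors cancel in every product
  and the two constant cross terms cancel each other. The identity is checked on functions;
  uniqueness of expansions carries it to the series.\<close>

lemma hermite_even_odd_product:
  "fps_const (1/4) * (hermite_gen_fps (\<i> * s) \<i> + hermite_gen_fps (\<i> * s) (- \<i>))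
       * (hermite_gen_fps s 1 - hermite_gen_fps s (- 1))
     = fps_const (1/4) * (fps_exp (4 * s) - fps_exp (- (4 * s)))"
proof (rule fps_expansion_unique_complex)
  let ?f = "\<lambda>z c t. exp (2 * z * (c * t) - (c * t) ^ 2) :: complex"
  have "(\<lambda>t. 1/4 * (?f (\<i> * s) \<i> t + ?f (\<i> * s) (- \<i>) t) * (?f s 1 t - ?f s (- 1) t))
     = (\<lambda>t. 1/4 * (exp (4 * s * t) - exp (- (4 * s) * t)))"
    by (rule ext) (simp add: algebra_simps flip: exp_add)
  moreover have "(\<lambda>t. 1/4 * (?f (\<i> * s) \<i> t + ?f (\<i> * s) (- \<i>) t) * (?f s 1 t - ?f s (- 1) t))
     has_fps_expansion (fps_const (1/4) * (hermite_gen_fps (\<i> * s) \<i> + hermite_gen_fps (\<i> * s) (- \<i>))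
       * (hermite_gen_fps s 1 - hermite_gen_fps s (- 1)))"
    by (intro has_fps_expansion_mult has_fps_expansion_add has_fps_expansion_diff
          has_fps_expansion_const hermite_gen_fps_expansion)
  ultimately show "(\<lambda>t. 1/4 * (exp (4 * s * t) - exp (- (4 * s) * t))) has_fps_expansion
    (fps_const (1/4) * (hermite_gen_fps (\<i> * s) \<i> + hermite_gen_fps (\<i> * s) (- \<i>))
       * (hermite_gen_fps s 1 - hermite_gen_fps s (- 1)))"
    by simp
  show "(\<lambda>t. 1/4 * (exp (4 * s * t) - exp (- (4 * s) * t))) has_fps_expansion
    (fps_const (1/4) * (fps_exp (4 * s) - fps_exp (- (4 * s))))"
    by (intro has_fps_expansion_mult has_fps_expansion_diff
          has_fps_expansion_const has_fps_expansion_exp)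
qed

lemma sum_atMost_odd_even_only:
  fixes f :: "nat \<Rightarrow> 'a::comm_monoid_add"
  assumes "\<And>k. odd k \<Longrightarrow> f k = 0"
  shows "(\<Sum>k\<le>2 * N + 1. f k) = (\<Sum>m\<le>N. f (2 * m))"
  by (induction N) (simp_all add: assms)

lemma hermite_diagonal_sum:
  "(\<Sum>m\<le>N. (- 1) ^ m * (hermite_H (2 * m) (\<i> * s) / fact (2 * m))
       * (hermite_H (2 * (N - m) + 1) s / fact (2 * (N - m) + 1)))
     = (4 * s) ^ (2 * N + 1) / (2 * fact (2 * N + 1))"
proof -
  \<comment> \<open>The constant 1/4 makes \<open>P\<close> half an even part, while
    \<open>Q\<close> is twice an odd part, so their product carries no extra factor.\<close>
  define P Q where "P = fps_const (1/4) * (hermite_gen_fps (\<i> * s) \<i> + hermite_gen_fps (\<i> * s) (- \<i>))"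
    and "Q = hermite_gen_fps s 1 - hermite_gen_fps s (- 1)"
  have P_odd: "fps_nth P k = 0" if "odd k" for k
    using that by (simp add: P_def hermite_gen_fps_def)
  have P_even: "fps_nth P (2 * m) = (- 1) ^ m * (hermite_H (2 * m) (\<i> * s) / fact (2 * m)) / 2" for m
    by (simp add: P_def hermite_gen_fps_def power_mult)
  have Q_odd: "fps_nth Q k = 2 * (hermite_H k s / fact k)" if "odd k" for k
    using that by (simp add: Q_def hermite_gen_fps_def)
  have "(4 * s) ^ (2 * N + 1) / (2 * fact (2 * N + 1)) = fps_nth (P * Q) (2 * N + 1)"
    unfolding P_def Q_def hermite_even_odd_product
    by (simp add: field_simps del: power_Suc fact_Suc)
  also have "\<dots> = (\<Sum>k\<le>2 * N + 1. fps_nth P k * fps_nth Q (2 * N + 1 - k))"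
    by (simp add: fps_mult_nth atLeast0AtMost)
  \<comment> \<open>\<open>P\<close> is even, so only the indices 2m survive; the complementary
    index in \<open>Q\<close> is then odd.\<close>
  also have "\<dots> = (\<Sum>m\<le>N. fps_nth P (2 * m) * fps_nth Q (2 * N + 1 - 2 * m))"
    by (rule sum_atMost_odd_even_only) (simp add: P_odd)
  also have "\<dots> = (\<Sum>m\<le>N. (- 1) ^ m * (hermite_H (2 * m) (\<i> * s) / fact (2 * m))
       * (hermite_H (2 * (N - m) + 1) s / fact (2 * (N - m) + 1)))"
  proof (rule sum.cong)
    fix m assume "m \<in> {..N}"
    then have "2 * N + 1 - 2 * m = 2 * (N - m) + 1" by auto
    then show "fps_nth P (2 * m) * fps_nth Q (2 * N + 1 - 2 * m) =
      (- 1) ^ m * (hermite_H (2 * m) (\<i> * s) / fact (2 * m))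
       * (hermite_H (2 * (N - m) + 1) s / fact (2 * (N - m) + 1))"
      by (simp add: P_even Q_odd del: fact_Suc)
  qed simp
  finally show ?thesis ..
qed

lemma pochhammer_half_times_fact:
  "pochhammer (1/2 :: 'a::field_char_0) m * fact m = fact (2 * m) / 4 ^ m"
  by (simp add: fact_double power_mult)

text \<open>Follows from the duplication formula for (2n+2)!, since (1/2, n+1) = (3/2, n)/2; the
  common factor 2(n+1) cancels.\<close>

lemma pochhammer_three_halves_times_fact:
  "pochhammer (3/2 :: 'a::field_char_0) n * fact n = fact (2 * n + 1) / 4 ^ n"
proof -
  have "fact (2 * Suc n) = (4 :: 'a) ^ Suc n * pochhammer (1/2) (Suc n) * fact (Suc n)"
    by (simp only: fact_double power_mult) simp
  also have "pochhammer (1/2 :: 'a) (Suc n) = pochhammer (3/2) n / 2"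
    by (simp add: pochhammer_rec)
  also have "fact (2 * Suc n) = (2 * of_nat (Suc n) * fact (2 * n + 1) :: 'a)"
    by (simp add: algebra_simps)
  finally have "of_nat (Suc n) * (2 * fact (2 * n + 1))
      = of_nat (Suc n) * (2 * (4 ^ n * (pochhammer (3/2) n * fact n)) :: 'a)"
    by (simp add: mult_ac del: of_nat_Suc)
  then show ?thesis
    by (simp add: field_simps del: of_nat_Suc fact_Suc)
qed

text \<open>The powers of 4 from the two factorial identities cancel the power of 2 down to 1/2.
  What remains in front depends on m + n only and can leave a diagonal sum.\<close>

lemma hermite_series_term_eq:
  "hermite_series_term x s m n = pochhammer (3/2) (m + n) * x ^ (m + n) / 2 *
     ((- 1) ^ m * (hermite_H (2 * m) (\<i> * s) / fact (2 * m))
       * (hermite_H (2 * n + 1) s / fact (2 * n + 1)))"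
proof -
  have power: "(2 :: complex) powi (- 1 - 2 * int m - 2 * int n) = 1 / (2 * 4 ^ m * 4 ^ n)"
  proof -
    have "- 1 - 2 * int m - 2 * int n = - int (1 + 2 * m + 2 * n)" by simp
    then show ?thesis
      by (simp only: power_int_minus power_int_of_nat power_add power_mult) (simp add: field_simps)
  qed
  have denominator: "pochhammer (1/2) m * pochhammer (3/2) n * fact m * fact n
      = fact (2 * m) / 4 ^ m * (fact (2 * n + 1) / 4 ^ n :: complex)"
    unfolding pochhammer_half_times_fact[symmetric] pochhammer_three_halves_times_fact[symmetric]
    by (simp only: mult_ac)
  show ?thesis
    unfolding hermite_series_term_def power denominator by (simp add: field_simps del: fact_Suc)
qed

text \<open>Writing (3/2, N) as (2N+1)!/(4^N N!) cancels the factorial of the diagonal sum, and 4 *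
  4^(2N) / (4 * 4^N) leaves 4^N.\<close>

lemma hermite_series_term_diagonal:
  "(\<Sum>m\<le>N. hermite_series_term x s m (N - m)) = s * ((4 * x * s ^ 2) ^ N / fact N)"
proof -
  have "(\<Sum>m\<le>N. hermite_series_term x s m (N - m))
      = pochhammer (3/2) N * x ^ N / 2 * ((4 * s) ^ (2 * N + 1) / (2 * fact (2 * N + 1)))"
    unfolding hermite_diagonal_sum[symmetric] sum_distrib_left
    by (rule sum.cong) (simp_all add: hermite_series_term_eq del: fact_Suc)
  also have "pochhammer (3/2) N = fact (2 * N + 1) / (4 ^ N * fact N :: complex)"
    using pochhammer_three_halves_times_fact[where 'a = complex, of N]
    by (simp add: field_simps del: fact_Suc)
  also have "(4 * s) ^ (2 * N + 1) = 4 * s * (4 ^ N * 4 ^ N * (s ^ 2) ^ N)"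
  proof -
    have "(4 * s) ^ (2 * N + 1) = 4 * s * ((4 * s) ^ 2) ^ N"
      unfolding power_add power_mult[of _ 2 N] by simp
    also have "(4 * s) ^ 2 = 4 * 4 * s ^ 2" by (simp add: power2_eq_square)
    finally show ?thesis by (simp only: power_mult_distrib)
  qed
  finally show ?thesis
    by (simp add: field_simps del: fact_Suc)
qed

text \<open>Pairs are reindexed by their sum N and first entry m. Summability over all pairs permits
  the iterated sum, whose inner sums are finite.\<close>

lemma infsum_nat_pairs_diagonal:
  fixes f :: "nat \<Rightarrow> nat \<Rightarrow> 'a::banach"
  assumes "(\<lambda>(m, n). f m n) summable_on UNIV"
  shows "(\<Sum>\<^sub>\<infinity>(m, n)\<in>UNIV. f m n) = (\<Sum>\<^sub>\<infinity>N. \<Sum>m\<le>N. f m (N - m))"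
proof -
  have bij: "bij_betw (\<lambda>(N, m). (m, N - m)) (SIGMA N:UNIV. {..N}) (UNIV :: (nat \<times> nat) set)"
    by (rule bij_betwI[where g = "\<lambda>(m, n). (m + n, m)"]) auto
  have "(\<lambda>(N, m). f m (N - m)) summable_on (SIGMA N:UNIV. {..N})"
    using assms summable_on_reindex_bij_betw[OF bij, of "\<lambda>(m, n). f m n"]
    by (simp add: case_prod_unfold)
  then have "(\<Sum>\<^sub>\<infinity>(N, m)\<in>(SIGMA N:UNIV. {..N}). f m (N - m)) = (\<Sum>\<^sub>\<infinity>N. \<Sum>\<^sub>\<infinity>m\<in>{..N}. f m (N - m))"
    by (rule infsum_Sigma'_banach[symmetric])
  then show ?thesis
    using infsum_reindex_bij_betw[OF bij, of "\<lambda>(m, n). f m n"]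
    by (simp add: case_prod_unfold)
qed

text \<open>\<open>s\<close> is either square root of \<open>y\<close>, the same one in both Hermite
  factors. Convergence is read as unconditional summability over pairs, which includes the
  terminating case.\<close>

theorem mainTheorem9:
  fixes x y s :: complex
  assumes "s ^ 2 = y"
    and "(\<lambda>(m, n). hermite_series_term x s m n) summable_on UNIV"
  shows "(\<Sum>\<^sub>\<infinity>(m, n)\<in>UNIV. hermite_series_term x s m n) = s * exp (4 * x * y)"
proof -
  \<comment> \<open>Absolute convergence turns the ordered exponential series into an unordered
    sum.\<close>
  have "((\<lambda>N. (4 * x * y) ^ N / fact N) has_sum exp (4 * x * y)) UNIV"
    using summable_norm_exp[of "4 * x * y"] exp_converges[of "4 * x * y"]
    by (intro norm_summable_imp_has_sum) (simp_all add: scaleR_conv_of_real divide_inverse mult.commute)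
  then have "((\<lambda>N. s * ((4 * x * y) ^ N / fact N)) has_sum (s * exp (4 * x * y))) UNIV"
    by (rule has_sum_cmult_right)
  then show ?thesis
    unfolding infsum_nat_pairs_diagonal[OF assms(2)] hermite_series_term_diagonal assms(1)
    by (rule infsumI)
qed

end
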